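(* There exist knowledge sets for which the greedy circumcenter policy has worst-case regret linear in the time horizon: there exist dimensions $d\ge 2$, $n\ge 1$ and a nonempty closed set $C\subseteq S^d$ such that $$\mathcal{WCR}_T^{\pi_{greedy}}(C)=\Omega(T)\qquad (T\to\infty),$$ i.e. there are constants $k>0$ and $T_0$ with $\mathcal{WCR}_T^{\pi_{greedy}}(C)\ge kT$ for all $T\ge T_0$.
   Context: Notation: $S^d$ is the unit Euclidean sphere of $\mathbb R^d$; $\mathcal B$ is the set of nonempty compact subsets of $\mathbb R^n$ of diameter at most $1$; $\mathcal F$ is the set of $1$-Lipschitz functions $\mathbb R^n\to\mathbb R^d$; $\psi(c,\mathcal X,f)=\arg\min_{x\in\mathcal X}f(x)'c$. Angles: $\theta(c,\hat c)=\arccos\frac{c'\hat c}{\|c\|\|\hat c\|}$. For a nonempty $C\subseteq\mathbb R^d$, the uncertainty angle is $\alpha(C)=\inf_{\hat c\in S^d}\sup_{c\in C}\theta(c,\hat c)$, and a circumcenter $\hat c(C)\in S^d$ is a minimizer (one always exists; it is unique if $C\setminus\{0\}\ne\emptyset$ and $\alpha(C)<\pi/2$). Online problem with horizon $T$ and initial knowledge set $C_0\subseteq S^d$ (closed): an unknown $c^\star\in C_0$ is fixed. In each period $t=1,\dots,T$, $\mathcal X_t\in\mathcal B$ and $f_t\in\mathcal F$ are revealed, the decision-maker chooses $x_t^\pi\in\mathcal X_t$ based on the information $\mathcal I_t$ (all past $(\mathcal X_s,f_s,x_s^\pi,x_s^\star)$, $s<t$, and the current $\mathcal X_t,f_t$),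 and then an optimal action $x_t^\star\in\psi(c^\star,\mathcal X_t,f_t)$ is revealed. The set of consistent costs at time $t$ is $C(\mathcal I_t)=\{c\in C_0:\ c'f_s(x_s^\star)\le c'f_s(x)\ \forall x\in\mathcal X_s,\ s=1,\dots,t-1\}$. Regret: $\mathcal{WCR}^\pi_T(C_0)=\sup \sum_{t=1}^T\bigl(f_t(x_t^\pi)-f_t(x_t^\star)\bigr)'c^\star$, the supremum being over $c^\star\in C_0$, $(\mathcal X_1,\dots,\mathcal X_T)\in\mathcal B^T$, $(f_1,\dots,f_T)\in\mathcal F^T$. The greedy circumcenter policy $\pi_{greedy}$ chooses $x_t^\pi\in\psi(\hat c(C(\mathcal I_t)),\mathcal X_t,f_t)$ in every period $t\le T$ (any selection in case of ties). *)

theory Defs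
  imports "HOL-Analysis.Analysis"
begin

(* The dimensions have to be quantified inside the statement, so R^m is not a type here but
   the carrier of the library topology Euclidean_space m: the functions nat => real that
   vanish at all indices >= m, with the product topology (which on this set is the usual
   topology of R^m). *)

type_synonym vect = "nat \<Rightarrow> real"

abbreviation Rvec :: "nat \<Rightarrow> vect set" where
  "Rvec m \<equiv> topspace (Euclidean_space m)"

definition dotp :: "nat \<Rightarrow> vect \<Rightarrow> vect \<Rightarrow> real" where
  "dotp m u v = (\<Sum>i<m. u i * v i)"

definition vnorm :: "nat \<Rightarrow> vect \<Rightarrow> real" where
  "vnorm m u = L2_set u {..<m}"

definition vdist :: "nat \<Rightarrow> vect \<Rightarrow> vect \<Rightarrow> real" where
  "vdist m u v = vnorm m (\<lambda>i. u i - v i)"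

(* Unit sphere of R^d, of topological dimension d - 1. *)
definition usphere :: "nat \<Rightarrow> vect set" where
  "usphere d = {u \<in> Rvec d. vnorm d u = 1}"

definition feasible_sets :: "nat \<Rightarrow> vect set set" where
  "feasible_sets n =
     {X. X \<noteq> {} \<and> compactin (Euclidean_space n) X \<and> (\<forall>x\<in>X. \<forall>y\<in>X. vdist n x y \<le> 1)}"

(* Only the values on R^n matter. *)
definition context_functions :: "nat \<Rightarrow> nat \<Rightarrow> (vect \<Rightarrow> vect) set" where
  "context_functions n d =
     {f. f \<in> Rvec n \<rightarrow> Rvec d \<and>
         (\<forall>x\<in>Rvec n. \<forall>y\<in>Rvec n. vdist d (f x) (f y) \<le> vdist n x y)}"

definition argmin_set :: "nat \<Rightarrow> vect \<Rightarrow> vect set \<Rightarrow> (vect \<Rightarrow> vect) \<Rightarrow> vect set" where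
  "argmin_set d c X f = {x. is_arg_min (\<lambda>y. dotp d (f y) c) (\<lambda>y. y \<in> X) x}"

(* If one argument is 0, division by zero makes this pi/2. *)
definition angle :: "nat \<Rightarrow> vect \<Rightarrow> vect \<Rightarrow> real" where
  "angle d c c' = arccos (dotp d c c' / (vnorm d c * vnorm d c'))"

definition uncertainty_angle :: "nat \<Rightarrow> vect set \<Rightarrow> real" where
  "uncertainty_angle d C = (INF u\<in>usphere d. SUP c\<in>C. angle d c u)"

definition is_circumcenter :: "nat \<Rightarrow> vect set \<Rightarrow> vect \<Rightarrow> bool" where
  "is_circumcenter d C u \<longleftrightarrow>
     u \<in> usphere d \<and> (SUP c\<in>C. angle d c u) = uncertainty_angle d C"

(* A map assigning to every nonempty subset of R^d one of its circumcenters. *)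
definition circumcenter_map :: "nat \<Rightarrow> (vect set \<Rightarrow> vect) \<Rightarrow> bool" where
  "circumcenter_map d cc \<longleftrightarrow>
     (\<forall>C. C \<noteq> {} \<and> C \<subseteq> Rvec d \<longrightarrow> is_circumcenter d C (cc C))"

(* One past period: (feasible set, context function, action taken, revealed optimal action).
   A history lists the past periods, oldest first. *)
type_synonym period = "vect set \<times> (vect \<Rightarrow> vect) \<times> vect \<times> vect"
type_synonym history = "period list"

(* The information available in a period is the history together with the current feasible
   set and context function. *)
type_synonym policy = "history \<Rightarrow> vect set \<Rightarrow> (vect \<Rightarrow> vect) \<Rightarrow> vect"

(* Rule by which an optimal action is picked for revelation when there are several: it may
   depend on the history, the true cost and the current instance. *)
type_synonym feedback = "history \<Rightarrow> vect \<Rightarrow> vect set \<Rightarrow> (vect \<Rightarrow> vect) \<Rightarrow> vect"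

definition consistent_costs :: "nat \<Rightarrow> vect set \<Rightarrow> history \<Rightarrow> vect set" where
  "consistent_costs d C0 h =
     {c \<in> C0. \<forall>(X, f, x_pol, x_opt) \<in> set h. \<forall>x\<in>X. dotp d c (f x_opt) \<le> dotp d c (f x)}"

(* Nothing is required on histories that contradict C0; these never occur. *)
definition greedy_policy ::
  "nat \<Rightarrow> nat \<Rightarrow> vect set \<Rightarrow> (vect set \<Rightarrow> vect) \<Rightarrow> policy \<Rightarrow> bool" where
  "greedy_policy d n C0 cc \<pi> \<longleftrightarrow>
     (\<forall>h. \<forall>X\<in>feasible_sets n. \<forall>f\<in>context_functions n d.
        consistent_costs d C0 h \<noteq> {} \<longrightarrow>
        \<pi> h X f \<in> argmin_set d (cc (consistent_costs d C0 h)) X f)"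

definition optimal_feedback :: "nat \<Rightarrow> nat \<Rightarrow> vect set \<Rightarrow> feedback \<Rightarrow> bool" where
  "optimal_feedback d n C0 \<phi> \<longleftrightarrow>
     (\<forall>h. \<forall>c\<in>C0. \<forall>X\<in>feasible_sets n. \<forall>f\<in>context_functions n d.
        \<phi> h c X f \<in> argmin_set d c X f)"

(* Periods are numbered 0, ..., T - 1; play ... t is the history before period t. *)
primrec play ::
  "policy \<Rightarrow> feedback \<Rightarrow> vect \<Rightarrow> (nat \<Rightarrow> vect set) \<Rightarrow> (nat \<Rightarrow> vect \<Rightarrow> vect) \<Rightarrow> nat \<Rightarrow> history" where
  "play \<pi> \<phi> c X f 0 = []"
| "play \<pi> \<phi> c X f (Suc t) =
     (let h = play \<pi> \<phi> c X f t
      in h @ [(X t, f t, \<pi> h (X t) (f t), \<phi> h c (X t) (f t))])"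

definition regret ::
  "nat \<Rightarrow> policy \<Rightarrow> feedback \<Rightarrow> nat \<Rightarrow> vect \<Rightarrow> (nat \<Rightarrow> vect set) \<Rightarrow> (nat \<Rightarrow> vect \<Rightarrow> vect) \<Rightarrow> real" where
  "regret d \<pi> \<phi> T c X f =
     (\<Sum>t<T. let h = play \<pi> \<phi> c X f t;
                x_pol = \<pi> h (X t) (f t);
                x_opt = \<phi> h c (X t) (f t)
            in dotp d (\<lambda>i. f t x_pol i - f t x_opt i) c)"

(* X and f are infinite sequences of which only the first T terms are constrained and used. *)
definition worst_case_regret ::
  "nat \<Rightarrow> nat \<Rightarrow> vect set \<Rightarrow> policy \<Rightarrow> feedback \<Rightarrow> nat \<Rightarrow> ereal" where
  "worst_case_regret d n C0 \<pi> \<phi> T =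
     (SUP (c, X, f) \<in> {(c, X, f). c \<in> C0 \<and> (\<forall>t<T. X t \<in> feasible_sets n) \<and>
                                  (\<forall>t<T. f t \<in> context_functions n d)}.
        ereal (regret d \<pi> \<phi> T c X f))"

end

theory Submission
  imports Defs
begin

text \<open>
  Take in the sphere of three-space the point B = (1, 0, 0) together with the arc of points
  A(s) = (s, sqrt (1 - 2 s^2), s) with s between 0 and 1/2. As s grows, A(s) approaches B so fast
  that the circumcenter of B and the part of the arc beyond s is the midpoint of B and A(s) alone.
  A direction orthogonal to B that separates A(s) from the slightly later A(r) is negative on this
  midpoint, so the greedy policy errs, but the feedback only removes the arc between s and r. With
  the true cost at the end of the arc each such error costs a constant, and by choosing the
  parameters at distance 1/(4 T) this can be repeated T times.
\<close>

section \<open>Circumcenters determined by two points\<close>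

lemma dotp_add_right: "dotp d u (\<lambda>i. v i + w i) = dotp d u v + dotp d u w"
  by (simp add: dotp_def algebra_simps sum.distrib)

lemma dotp_commute: "dotp d u v = dotp d v u"
  by (simp add: dotp_def mult.commute)

lemma dotp_divide_right: "dotp d u (\<lambda>i. v i / k) = dotp d u v / k"
  by (simp add: dotp_def sum_divide_distrib)

lemma vnorm_power2: "(vnorm d u)\<^sup>2 = dotp d u u"
  by (simp add: vnorm_def dotp_def L2_set_def sum_nonneg power2_eq_square)

lemma dotp_self_usphere: "u \<in> usphere d \<Longrightarrow> dotp d u u = 1"
  by (simp add: usphere_def flip: vnorm_power2)

lemma abs_dotp_le: "\<bar>dotp d u v\<bar> \<le> vnorm d u * vnorm d v"
proof -
  have "\<bar>dotp d u v\<bar> \<le> (\<Sum>i<d. \<bar>u i\<bar> * \<bar>v i\<bar>)"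
    unfolding dotp_def by (metis (no_types, lifting) abs_mult sum.cong sum_abs)
  also have "\<dots> \<le> vnorm d u * vnorm d v"
    unfolding vnorm_def by (rule L2_set_mult_ineq)
  finally show ?thesis .
qed

lemma angle_usphere:
  assumes "u \<in> usphere d" "v \<in> usphere d"
  shows "angle d u v = arccos (dotp d u v)" "\<bar>dotp d u v\<bar> \<le> 1"
  using assms abs_dotp_le[of d u v] by (simp_all add: angle_def usphere_def)

text \<open>Let \<open>w\<close> be a + b, \<open>N\<close> its norm and \<open>m\<close> =
  \<open>w\<close> / \<open>N\<close>. By \<open>enclosed\<close>, \<open>m\<close> has inner
  product at least \<kappa> = \<open>N\<close> / 2 with every point of \<open>C\<close>, so by
  optimality the circumcenter \<open>u\<close> does too. Adding this for a and b puts
  \<open>u\<close> in the equality case of Cauchy-Schwarz with \<open>w\<close>, hence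
  \<open>u\<close> = \<open>m\<close>. As any circumcenter is covered, the selection made by a
  circumcenter map does not matter.\<close>

lemma is_circumcenter_midpoint:
  assumes C: "C \<subseteq> usphere d" and a: "a \<in> C" and b: "b \<in> C"
    and pos: "dotp d a b > -1"
    and enclosed: "\<And>c. c \<in> C \<Longrightarrow> dotp d c (\<lambda>i. a i + b i) \<ge> 1 + dotp d a b"
    and u: "is_circumcenter d C u" and i: "i < d"
  shows "u i = (a i + b i) / vnorm d (\<lambda>i. a i + b i)"
proof -
  define w where "w = (\<lambda>i. a i + b i)"
  define N where "N = vnorm d w"
  define m where "m = (\<lambda>i. w i / N)"
  define \<kappa> where "\<kappa> = (1 + dotp d a b) / N"
  have aS: "a \<in> usphere d" and bS: "b \<in> usphere d" and uS: "u \<in> usphere d"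
    using C a b u by (auto simp: is_circumcenter_def)
  have aa: "dotp d a a = 1" and bb: "dotp d b b = 1" and uu: "dotp d u u = 1"
    using aS bS uS by (simp_all add: dotp_self_usphere)
  have ww: "dotp d w w = 2 + 2 * dotp d a b"
    using aa bb unfolding w_def
    by (simp add: dotp_add_right dotp_commute[of _ "\<lambda>i. a i + b i"] dotp_commute[of d b a])
  have N2: "N\<^sup>2 = 2 + 2 * dotp d a b"
    unfolding N_def vnorm_power2 ww ..
  have N: "N > 0"
    using N2 pos unfolding N_def vnorm_def by (smt (verit) L2_set_nonneg zero_power2)
  have mS: "m \<in> usphere d"
  proof -
    have "(vnorm d m)\<^sup>2 = 1"
      unfolding vnorm_power2 unfolding m_def using ww N2 pos
      by (simp add: dotp_divide_right dotp_commute[of d "\<lambda>i. w i / N"] power2_eq_square)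
    then have "vnorm d m = 1"
      unfolding vnorm_def by (smt (verit) L2_set_nonneg power2_eq_1_iff)
    moreover have "m \<in> Rvec d"
      using aS bS by (auto simp: m_def w_def usphere_def topspace_Euclidean_space)
    ultimately show ?thesis by (simp add: usphere_def)
  qed
  \<comment> \<open>The supremum of reals is only meaningful for bounded sets; all angles are at
    most pi.\<close>
  have bdd: "bdd_above ((\<lambda>c. angle d c v) ` C)" if "v \<in> usphere d" for v
    using C that angle_usphere by (intro bdd_aboveI2[of _ _ pi]) (metis abs_le_iff arccos_ubound minus_le_iff subsetD)
  have \<kappa>: "-1 \<le> \<kappa>" "\<kappa> \<le> 1"
  proof -
    have "dotp d a m = \<kappa>"
      using aa by (simp add: m_def \<kappa>_def w_def dotp_divide_right dotp_add_right)
    then show "-1 \<le> \<kappa>" "\<kappa> \<le> 1"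
      using angle_usphere(2)[OF aS mS] by auto
  qed
  have "(SUP c\<in>C. angle d c m) \<le> arccos \<kappa>"
  proof (rule cSUP_least)
    fix c assume c: "c \<in> C"
    have "\<kappa> \<le> dotp d c m"
      using enclosed[OF c] N by (simp add: m_def \<kappa>_def w_def dotp_divide_right divide_right_mono)
    moreover have "c \<in> usphere d" using c C by auto
    ultimately show "angle d c m \<le> arccos \<kappa>"
      using \<kappa> angle_usphere[OF _ mS] by (simp add: abs_le_iff arccos_le_arccos)
  qed (use a in auto)
  moreover have "uncertainty_angle d C \<le> (SUP c\<in>C. angle d c m)"
    unfolding uncertainty_angle_def
  proof (rule cINF_lower[OF _ mS], rule bdd_belowI2[of _ 0])
    fix v assume v: "v \<in> usphere d"
    have "0 \<le> angle d a v"
      using angle_usphere[OF aS v] by (simp add: arccos_lbound abs_le_iff)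
    then show "0 \<le> (SUP c\<in>C. angle d c v)"
      using cSUP_upper[OF a bdd[OF v]] by linarith
  qed
  ultimately have sup_u: "(SUP c\<in>C. angle d c u) \<le> arccos \<kappa>"
    using u by (simp add: is_circumcenter_def)
  have ge: "\<kappa> \<le> dotp d u c" if c: "c \<in> C" for c
  proof -
    have cS: "c \<in> usphere d" using c C by auto
    have "angle d c u \<le> arccos \<kappa>"
      using cSUP_upper[OF c bdd[OF uS]] sup_u by linarith
    then show ?thesis
      using angle_usphere[OF cS uS] \<kappa> arccos_le_mono[of "dotp d c u" \<kappa>]
      by (simp add: dotp_commute)
  qed
  have "dotp d u w \<ge> N"
  proof -
    have "N * N = N * (2 * \<kappa>)"
      using N N2 by (simp add: \<kappa>_def power2_eq_square)
    then have "N = 2 * \<kappa>" using N by simp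
    then show ?thesis
      using ge[OF a] ge[OF b] by (simp add: w_def dotp_add_right)
  qed
  \<comment> \<open>The squared norm of \<open>N\<close> u - \<open>w\<close>: since |u| = 1 and
    |\<open>w\<close>| = \<open>N\<close>, the bound <u, \<open>w\<close>> \<ge> \<open>N\<close>
    makes it at most 0.\<close>
  moreover have "(\<Sum>j<d. (N * u j - w j)\<^sup>2) = N\<^sup>2 * dotp d u u - 2 * N * dotp d u w + dotp d w w"
    unfolding dotp_def sum_distrib_left
    by (simp add: power2_eq_square algebra_simps sum.distrib sum_subtractf)
  ultimately have "(\<Sum>j<d. (N * u j - w j)\<^sup>2) \<le> 0"
    using N uu ww N2 mult_left_mono[of N "dotp d u w" N] by (simp add: power2_eq_square)
  then have "(\<Sum>j<d. (N * u j - w j)\<^sup>2) = 0"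
    by (intro antisym sum_nonneg) auto
  then have "(N * u i - w i)\<^sup>2 = 0"
    using i by (subst (asm) sum_nonneg_eq_0_iff) auto
  then show ?thesis
    using N unfolding N_def w_def by (simp add: field_simps)
qed

section \<open>The knowledge set\<close>

definition vec3 :: "real \<Rightarrow> real \<Rightarrow> real \<Rightarrow> vect" where
  "vec3 x y z = (\<lambda>i. if i = 0 then x else if i = 1 then y else if i = 2 then z else 0)"

lemma vec3_nth [simp]: "vec3 x y z 0 = x" "vec3 x y z (Suc 0) = y" "vec3 x y z 2 = z"
  by (simp_all add: vec3_def)

lemma dotp_3: "dotp 3 u v = u 0 * v 0 + u (Suc 0) * v (Suc 0) + u 2 * v 2"
  by (simp add: dotp_def eval_nat_numeral)

lemma vec3_Rvec: "vec3 x y z \<in> Rvec 3"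
  by (simp add: topspace_Euclidean_space vec3_def)

lemma Rvec3_eq_vec3: "v \<in> Rvec 3 \<Longrightarrow> v = vec3 (v 0) (v 1) (v 2)"
proof
  fix i :: nat assume v: "v \<in> Rvec 3"
  consider "i = 0" | "i = 1" | "i = 2" | "i \<ge> 3" by linarith
  then show "v i = vec3 (v 0) (v 1) (v 2) i"
    using v by cases (auto simp: topspace_Euclidean_space vec3_def)
qed

lemma usphere_3_iff:
  "u \<in> usphere 3 \<longleftrightarrow> u \<in> Rvec 3 \<and> (u 0)\<^sup>2 + (u (Suc 0))\<^sup>2 + (u 2)\<^sup>2 = 1"
proof -
  have "vnorm 3 u = 1 \<longleftrightarrow> (vnorm 3 u)\<^sup>2 = 1"
    unfolding vnorm_def by (smt (verit) L2_set_nonneg power2_eq_1_iff)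
  then show ?thesis
    unfolding usphere_def vnorm_power2 by (auto simp: dotp_3 power2_eq_square)
qed

definition height :: "real \<Rightarrow> real" where
  "height s = sqrt (1 - 2 * s\<^sup>2)"

text \<open>The points lie on the great circle where the first and third coordinates agree, starting
  at (0, 1, 0). The inner product with B is s.\<close>

definition arc_point :: "real \<Rightarrow> vect" where
  "arc_point s = vec3 s (height s) s"

definition arc_set :: "real \<Rightarrow> vect set" where
  "arc_set s = insert (vec3 1 0 0) (arc_point ` {s..1/2})"

lemma power2_le_quarter: "0 \<le> s \<Longrightarrow> s \<le> 1/2 \<Longrightarrow> s\<^sup>2 \<le> 1/4" for s :: real
  using power_mono[of s "1/2" 2] by (simp add: power2_eq_square)

lemma height_power2: "0 \<le> s \<Longrightarrow> s \<le> 1/2 \<Longrightarrow> (height s)\<^sup>2 = 1 - 2 * s\<^sup>2"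
  using power2_le_quarter[of s] by (simp add: height_def)

lemma height_pos: "0 \<le> s \<Longrightarrow> s \<le> 1/2 \<Longrightarrow> 0 < height s"
  using power2_le_quarter[of s] by (simp add: height_def)

lemma height_antimono: "0 \<le> s \<Longrightarrow> s \<le> t \<Longrightarrow> height t \<le> height s"
  by (simp add: height_def power_mono)

text \<open>
  The left-hand side is half the squared distance of the two arc points: quadratic in t - s,
  whereas the inner product with B grows linearly.
\<close>

lemma arc_distance_le:
  assumes "0 \<le> s" "s \<le> t" "t \<le> 1/2"
  shows "1 - 2 * s * t - height s * height t \<le> t - s"
proof -
  let ?p = "height s" and ?q = "height t"
  have p: "?p\<^sup>2 = 1 - 2 * s\<^sup>2" "0 < ?p" and q: "?q\<^sup>2 = 1 - 2 * t\<^sup>2" "0 < ?q"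
    using assms by (simp_all add: height_power2 height_pos)
  have qp: "?q \<le> ?p"
    using assms by (intro height_antimono)
  have half: "?q\<^sup>2 \<ge> 1/2"
    using power2_le_quarter[of t] assms q by simp
  \<comment> \<open>Keeping the sum of the heights away from 0 bounds their difference through the
    difference of their squares, which is explicit.\<close>
  have "(?p + ?q)\<^sup>2 \<ge> (2 * ?q)\<^sup>2"
    using qp q by (intro power_mono) auto
  then have "(?p + ?q)\<^sup>2 \<ge> 2"
    using half by (simp add: power_mult_distrib)
  then have "(?p - ?q)\<^sup>2 * 2 \<le> (?p - ?q)\<^sup>2 * (?p + ?q)\<^sup>2"
    by (intro mult_left_mono) auto
  also have "\<dots> = (?p\<^sup>2 - ?q\<^sup>2)\<^sup>2"
    by (simp add: power2_eq_square algebra_simps)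
  also have "\<dots> = 4 * (t - s)\<^sup>2 * (t + s)\<^sup>2"
    unfolding p q by (simp add: power2_eq_square algebra_simps)
  also have "\<dots> \<le> 4 * (t - s)\<^sup>2 * 1"
    using assms by (intro mult_left_mono) (auto simp: power_le_one)
  finally have "(?p - ?q)\<^sup>2 \<le> 2 * (t - s)\<^sup>2" by simp
  moreover have "1 - 2 * s * t - ?p * ?q = (t - s)\<^sup>2 + (?p - ?q)\<^sup>2 / 2"
    using p q by (simp add: power2_diff field_simps)
  ultimately have "1 - 2 * s * t - ?p * ?q \<le> 2 * (t - s)\<^sup>2" by simp
  \<comment> \<open>Here the restriction of the arc to parameters at most 1/2 turns the quadratic
    bound into a linear one.\<close>
  also have "\<dots> \<le> t - s"
    using mult_right_mono[of "t - s" "1/2" "t - s"] assms by (simp add: power2_eq_square)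
  finally show ?thesis .
qed

lemma arc_set_subset_usphere: "0 \<le> s \<Longrightarrow> arc_set s \<subseteq> usphere 3"
  by (auto simp: arc_set_def arc_point_def usphere_3_iff vec3_Rvec height_power2)

lemma closedin_arc_set: "closedin (Euclidean_space 3) (arc_set 0)"
proof -
  \<comment> \<open>The square root is replaced by an equation and a sign condition, so that
    closedness follows from continuity of the coordinates.\<close>
  define S :: "vect set" where
    "S = {v. v 0 = 1 \<and> v 1 = 0 \<and> v 2 = 0} \<union>
         {v. v 0 = v 2 \<and> 0 \<le> v 0 \<and> v 0 \<le> 1/2 \<and> 0 \<le> v 1 \<and> (v 1)\<^sup>2 = 1 - 2 * (v 0)\<^sup>2}"
  have "closed S"
    unfolding S_def
    by (intro closed_Un closed_Collect_conj closed_Collect_eq closed_Collect_le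
        continuous_intros continuous_on_product_coordinates)
  moreover have "arc_set 0 = S \<inter> {x. \<forall>i\<ge>3. x i = 0}"
  proof (intro set_eqI iffI)
    fix v assume "v \<in> arc_set 0"
    then show "v \<in> S \<inter> {x. \<forall>i\<ge>3. x i = 0}"
      using height_power2 height_pos
      by (auto simp: arc_set_def S_def arc_point_def less_imp_le) (auto simp: vec3_def)
  next
    fix v assume v: "v \<in> S \<inter> {x. \<forall>i\<ge>3. x i = 0}"
    then have eq: "v = vec3 (v 0) (v 1) (v 2)"
      by (intro Rvec3_eq_vec3) (simp add: topspace_Euclidean_space)
    from v consider "v 0 = 1" "v 1 = 0" "v 2 = 0"
      | "v 0 = v 2" "0 \<le> v 0" "v 0 \<le> 1/2" "0 \<le> v 1" "(v 1)\<^sup>2 = 1 - 2 * (v 0)\<^sup>2"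
      by (auto simp: S_def)
    then show "v \<in> arc_set 0"
    proof cases
      case 1
      then show ?thesis using eq by (simp add: arc_set_def)
    next
      case 2
      then have "v 1 = height (v 0)"
        unfolding height_def by (metis real_sqrt_abs abs_of_nonneg)
      with 2 eq have "v = arc_point (v 0)" by (simp add: arc_point_def)
      with 2 show ?thesis unfolding arc_set_def by (metis atLeastAtMost_iff imageI insertI2)
    qed
  qed
  ultimately show ?thesis
    unfolding Euclidean_space_def closedin_subtopology euclidean_product_topology closed_closedin
    by blast
qed

section \<open>Cutting directions\<close>

text \<open>The cross product of B and \<open>arc_point r\<close>, hence orthogonal to both. Its
  squared norm is 1 - r^2 for 0 \<le> r \<le> 1/2.\<close>

definition cut_dir :: "real \<Rightarrow> vect" where
  "cut_dir r = vec3 0 (- r) (height r)"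

lemma dotp_cut_arc: "dotp 3 (arc_point s) (cut_dir r) = height r * s - r * height s"
  by (simp add: dotp_3 arc_point_def cut_dir_def algebra_simps)

text \<open>The sign is that of s / \<open>height s\<close> - r / \<open>height r\<close>, and this
  quotient grows with the parameter because \<open>height\<close> decreases.\<close>

lemma dotp_cut_arc_neg:
  assumes "0 \<le> s" "s < r" "r \<le> 1/2"
  shows "dotp 3 (arc_point s) (cut_dir r) < 0"
proof -
  have "height r * s < height r * r"
    using assms by (intro mult_strict_left_mono height_pos) auto
  also have "\<dots> \<le> r * height s"
    using assms by (simp add: mult.commute height_antimono mult_left_mono)
  finally show ?thesis by (simp add: dotp_cut_arc)
qed

lemma dotp_cut_arc_nonneg:
  assumes "0 \<le> r" "r \<le> s" "s \<le> 1/2"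
  shows "0 \<le> dotp 3 (arc_point s) (cut_dir r)"
proof -
  have "r * height s \<le> s * height r"
    using assms height_pos[of s] by (intro mult_mono height_antimono) auto
  then show ?thesis by (simp add: dotp_cut_arc mult.commute)
qed

text \<open>This is the loss per error. Cuts up to 1/4 stay away from the end of the arc: 3/4 * 1/2
  - 1/4 * 1 = 1/8.\<close>

lemma dotp_cut_arc_end:
  assumes "0 \<le> r" "r \<le> 1/4"
  shows "1/8 \<le> dotp 3 (arc_point (1/2)) (cut_dir r)"
proof -
  have "r\<^sup>2 \<le> (1/4)\<^sup>2" using assms by (intro power_mono) auto
  then have "(3/4)\<^sup>2 \<le> 1 - 2 * r\<^sup>2" by (simp add: power2_eq_square)
  then have "3/4 \<le> height r" unfolding height_def by (rule real_le_rsqrt)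
  moreover have "height (1/2) \<le> 1" by (simp add: height_def)
  then have "r * height (1/2) \<le> r * 1" using assms by (intro mult_left_mono) auto
  ultimately show ?thesis using assms by (simp add: dotp_cut_arc)
qed

text \<open>The circumcenter is a positive multiple of B + A(s), the enclosing condition at A(t)
  being \<open>arc_distance_le\<close>. As the cut is orthogonal to B, only the negative
  contribution of A(s) remains.\<close>

lemma dotp_cut_circumcenter_neg:
  assumes s: "0 \<le> s" "s < r" "r \<le> 1/2" and u: "is_circumcenter 3 (arc_set s) u"
  shows "dotp 3 (cut_dir r) u < 0"
proof -
  let ?B = "vec3 1 0 0"
  define w where "w = (\<lambda>i. ?B i + arc_point s i)"
  have sph: "arc_set s \<subseteq> usphere 3" using s by (simp add: arc_set_subset_usphere)
  have B: "?B \<in> arc_set s" and A: "arc_point s \<in> arc_set s" using s by (auto simp: arc_set_def)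
  have BA: "dotp 3 ?B (arc_point s) = s" by (simp add: dotp_3 arc_point_def)
  have "1 + s \<le> dotp 3 c w" if c: "c \<in> arc_set s" for c
  proof -
    consider "c = ?B" | t where "c = arc_point t" "s \<le> t" "t \<le> 1/2"
      using c by (auto simp: arc_set_def)
    then show ?thesis
    proof cases
      case 1
      then show ?thesis by (simp add: w_def dotp_3 arc_point_def)
    next
      case 2
      then show ?thesis
        using arc_distance_le[of s t] s by (simp add: w_def dotp_3 arc_point_def algebra_simps)
    qed
  qed
  then have "u i = w i / vnorm 3 w" if "i < 3" for i
    using is_circumcenter_midpoint[OF sph B A _ _ u that] s by (simp add: BA w_def)
  then have "dotp 3 (cut_dir r) u = dotp 3 (cut_dir r) w / vnorm 3 w"
    by (simp add: dotp_def sum_divide_distrib)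
  also have "dotp 3 (cut_dir r) w = dotp 3 (arc_point s) (cut_dir r)"
    by (simp add: w_def dotp_3 cut_dir_def arc_point_def algebra_simps)
  finally have eq: "dotp 3 (cut_dir r) u = dotp 3 (arc_point s) (cut_dir r) / vnorm 3 w" .
  \<comment> \<open>The first coordinate of \<open>w\<close> is 1 + s, so the norm in the
    denominator is not 0; division by zero would lose the strict sign.\<close>
  have "dotp 3 w w \<ge> (1 + s)\<^sup>2"
    by (simp add: dotp_3 w_def arc_point_def power2_eq_square)
  then have "vnorm 3 w > 0"
    using s vnorm_power2[of 3 w] unfolding vnorm_def
    by (smt (verit) L2_set_nonneg zero_less_power zero_power2)
  then show ?thesis
    using dotp_cut_arc_neg[OF s] by (simp add: eq divide_neg_pos)
qed

section \<open>Instances\<close>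

definition unit_vec :: vect where
  "unit_vec = (\<lambda>i. if i = 0 then 1 else 0)"

definition two_points :: "vect set" where
  "two_points = {\<lambda>i. 0, unit_vec}"

text \<open>On \<open>two_points\<close> the choice is between 0 and v, so the sign of <v, c> alone
  decides which action is optimal.\<close>

definition scale_map :: "vect \<Rightarrow> vect \<Rightarrow> vect" where
  "scale_map v x = (\<lambda>i. x 0 * v i)"

lemma two_points_feasible: "two_points \<in> feasible_sets 1"
  by (auto simp: feasible_sets_def two_points_def unit_vec_def topspace_Euclidean_space
      vdist_def vnorm_def L2_set_def intro!: finite_imp_compactin)

lemma scale_map_context:
  assumes "v \<in> Rvec d" "dotp d v v \<le> 1"
  shows "scale_map v \<in> context_functions 1 d"
proof -
  have "vdist d (scale_map v x) (scale_map v y) \<le> vdist 1 x y" for x y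
  proof -
    have "(vdist d (scale_map v x) (scale_map v y))\<^sup>2 = (x 0 - y 0)\<^sup>2 * dotp d v v"
      unfolding vdist_def vnorm_power2 dotp_def sum_distrib_left
      by (simp add: scale_map_def power2_eq_square algebra_simps)
    also have "\<dots> \<le> (x 0 - y 0)\<^sup>2 * 1"
      using assms by (intro mult_left_mono) auto
    also have "\<dots> = (vdist 1 x y)\<^sup>2"
      unfolding vdist_def vnorm_power2 by (simp add: dotp_def power2_eq_square)
    finally show ?thesis
      by (rule power2_le_imp_le) (simp add: vdist_def vnorm_def)
  qed
  then show ?thesis
    using assms by (auto simp: context_functions_def scale_map_def topspace_Euclidean_space)
qed

lemma cut_context:
  assumes "0 \<le> r" "r \<le> 1/2"
  shows "scale_map (cut_dir r) \<in> context_functions 1 3"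
  using assms height_power2[of r]
  by (intro scale_map_context) (auto simp: cut_dir_def vec3_Rvec dotp_3 power2_eq_square)

lemma dotp_scale_map: "dotp d (scale_map v x) c = x 0 * dotp d v c"
  by (simp add: dotp_def scale_map_def sum_distrib_left mult.assoc)

lemma dotp_scale_map_right: "dotp d c (scale_map v x) = x 0 * dotp d c v"
  by (metis dotp_commute dotp_scale_map)

lemma argmin_two_points_neg:
  assumes "dotp d v c < 0" "x \<in> argmin_set d c two_points (scale_map v)"
  shows "x = unit_vec"
  using assms
  by (auto simp: argmin_set_def is_arg_min_def two_points_def dotp_scale_map unit_vec_def)

lemma argmin_two_points_pos:
  assumes "dotp d v c > 0" "x \<in> argmin_set d c two_points (scale_map v)"
  shows "x = (\<lambda>i. 0)"
  using assms
  by (auto simp: argmin_set_def is_arg_min_def two_points_def dotp_scale_map unit_vec_def)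

text \<open>Allows updating period by period, with the current consistent set as the new knowledge
  set.\<close>

lemma consistent_costs_append:
  "consistent_costs d C (h @ h') = consistent_costs d (consistent_costs d C h) h'"
  unfolding consistent_costs_def set_append ball_Un by blast

text \<open>Revealing the zero action says exactly that <c, \<open>cut_dir r\<close>> \<ge> 0. B
  survives by orthogonality and A(r) with equality, so the set keeps its shape and the argument can
  be repeated.\<close>

lemma consistent_costs_cut:
  assumes "0 \<le> s" "s < r" "r \<le> 1/2"
  shows "consistent_costs 3 (arc_set s) [(two_points, scale_map (cut_dir r), x, \<lambda>i. 0)] = arc_set r"
proof -
  have "consistent_costs 3 (arc_set s) [(two_points, scale_map (cut_dir r), x, \<lambda>i. 0)] =
      {c \<in> arc_set s. 0 \<le> dotp 3 c (cut_dir r)}"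
    by (simp add: consistent_costs_def two_points_def dotp_scale_map_right unit_vec_def)
  also have "\<dots> = arc_set r"
    using assms dotp_cut_arc_nonneg[of r] dotp_cut_arc_neg[of _ r]
    by (fastforce simp: arc_set_def dotp_3[of "vec3 1 0 0"] cut_dir_def[of r] not_less[symmetric])
  finally show ?thesis .
qed

section \<open>The repeated error\<close>

text \<open>By induction the consistent set before period t is \<open>arc_set (r t)\<close>. The
  next cut then makes the greedy policy take \<open>unit_vec\<close> while 0 is optimal, which costs
  at least 1/8 in each period.\<close>

lemma regret_arc_ge:
  assumes T: "T \<ge> 1"
    and cc: "circumcenter_map 3 cc" and greedy: "greedy_policy 3 1 (arc_set 0) cc \<pi>"
    and feedback: "optimal_feedback 3 1 (arc_set 0) \<phi>"
  defines "r \<equiv> \<lambda>t. real t / (4 * real T)"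
  shows "1/8 * real T \<le>
    regret 3 \<pi> \<phi> T (arc_point (1/2)) (\<lambda>_. two_points) (\<lambda>t. scale_map (cut_dir (r (Suc t))))"
proof -
  let ?c = "arc_point (1/2)" and ?f = "\<lambda>t. scale_map (cut_dir (r (Suc t)))"
  let ?h = "play \<pi> \<phi> ?c (\<lambda>_. two_points) ?f"
  \<comment> \<open>The grid starts at 0, the full arc, and ends at \<open>r T\<close> = 1/4. Period
    t cuts at \<open>r (Suc t)\<close>, strictly beyond the current start \<open>r t\<close> of the
    arc.\<close>
  have r: "0 \<le> r t" "r t < r (Suc t)" "r (Suc t) \<le> 1/4" if "t < T" for t
    using that by (auto simp: r_def field_simps)
  have c: "?c \<in> arc_set 0" by (simp add: arc_set_def)
  \<comment> \<open>Strict positivity makes 0 the only optimal action, so every feedback rule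
    reveals it.\<close>
  have opt: "\<phi> h ?c two_points (?f t) = (\<lambda>i. 0)" if t: "t < T" for h t
  proof (rule argmin_two_points_pos)
    show "0 < dotp 3 (cut_dir (r (Suc t))) ?c"
      using dotp_cut_arc_end[of "r (Suc t)"] r[OF t] dotp_commute[of 3 ?c] by simp
    show "\<phi> h ?c two_points (?f t) \<in> argmin_set 3 ?c two_points (?f t)"
      using feedback c two_points_feasible cut_context[of "r (Suc t)"] r[OF t]
      by (simp add: optimal_feedback_def)
  qed
  have consistent: "consistent_costs 3 (arc_set 0) (?h t) = arc_set (r t)" if "t \<le> T" for t
    using that
  proof (induction t)
    case 0
    then show ?case by (simp add: consistent_costs_def r_def)
  next
    case (Suc t)
    then show ?case
      using r[of t] by (simp add: Let_def consistent_costs_append opt consistent_costs_cut)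
  qed
  \<comment> \<open>Strict negativity on the circumcenter likewise excludes ties, so every greedy
    selection errs.\<close>
  have pol: "\<pi> (?h t) two_points (?f t) = unit_vec" if t: "t < T" for t
  proof (rule argmin_two_points_neg)
    have sub: "arc_set (r t) \<noteq> {}" "arc_set (r t) \<subseteq> Rvec 3"
      using arc_set_subset_usphere[of "r t"] r[OF t] by (auto simp: arc_set_def usphere_def)
    then have "is_circumcenter 3 (arc_set (r t)) (cc (arc_set (r t)))"
      using cc by (simp add: circumcenter_map_def)
    then show "dotp 3 (cut_dir (r (Suc t))) (cc (arc_set (r t))) < 0"
      using r[OF t] by (intro dotp_cut_circumcenter_neg[of "r t"]) auto
    show "\<pi> (?h t) two_points (?f t) \<in> argmin_set 3 (cc (arc_set (r t))) two_points (?f t)"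
      using greedy[unfolded greedy_policy_def, rule_format, of two_points "?f t" "?h t"]
        two_points_feasible cut_context[of "r (Suc t)"] r[OF t] sub consistent[of t] t by simp
  qed
  have "1/8 \<le> dotp 3 (\<lambda>i. ?f t unit_vec i - ?f t (\<lambda>i. 0) i) ?c" if t: "t < T" for t
  proof -
    have "(\<lambda>i. ?f t unit_vec i - ?f t (\<lambda>i. 0) i) = cut_dir (r (Suc t))"
      by (simp add: scale_map_def unit_vec_def)
    then show ?thesis
      using dotp_cut_arc_end[of "r (Suc t)"] r[OF t] by (simp add: dotp_commute)
  qed
  then have "(\<Sum>t<T. 1/8) \<le> regret 3 \<pi> \<phi> T ?c (\<lambda>_. two_points) ?f"
    unfolding regret_def Let_def by (intro sum_mono) (simp add: pol opt)
  then show ?thesis by simp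
qed

theorem theorem2:
  shows "\<exists>d n :: nat. d \<ge> 2 \<and> n \<ge> 1 \<and>
    (\<exists>C. C \<noteq> {} \<and> C \<subseteq> usphere d \<and> closedin (Euclidean_space d) C \<and>
      (\<exists>k::real. k > 0 \<and> (\<exists>T0::nat. \<forall>T\<ge>T0. \<forall>cc \<pi> \<phi>.
         circumcenter_map d cc \<longrightarrow> greedy_policy d n C cc \<pi> \<longrightarrow> optimal_feedback d n C \<phi> \<longrightarrow>
         worst_case_regret d n C \<pi> \<phi> T \<ge> ereal (k * real T))))"
proof -
  have wcr: "ereal (1/8 * real T) \<le> worst_case_regret 3 1 (arc_set 0) \<pi> \<phi> T"
    if T: "T \<ge> 1" and *: "circumcenter_map 3 cc" "greedy_policy 3 1 (arc_set 0) cc \<pi>"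
      "optimal_feedback 3 1 (arc_set 0) \<phi>" for T cc \<pi> \<phi>
  proof -
    define f where "f = (\<lambda>t. scale_map (cut_dir (real (Suc t) / (4 * real T))))"
    have "f t \<in> context_functions 1 3" if "t < T" for t
      unfolding f_def using that by (intro cut_context) (auto simp: field_simps)
    then have "(arc_point (1/2), \<lambda>_. two_points, f) \<in> {(c, X, f). c \<in> arc_set 0 \<and>
        (\<forall>t<T. X t \<in> feasible_sets 1) \<and> (\<forall>t<T. f t \<in> context_functions 1 3)}"
      using two_points_feasible by (auto simp: arc_set_def)
    moreover have "ereal (1/8 * real T) \<le> ereal (regret 3 \<pi> \<phi> T (arc_point (1/2)) (\<lambda>_. two_points) f)"
      using regret_arc_ge[OF T *] unfolding f_def by simp
    ultimately show ?thesis
      unfolding worst_case_regret_def by (intro SUP_upper2) auto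
  qed
  show ?thesis
    using arc_set_subset_usphere[of 0] closedin_arc_set wcr
    by (intro exI[of _ 3] exI[of _ 1] conjI exI[of _ "arc_set 0"] exI[of _ "1/8"])
       (auto simp: arc_set_def)
qed

end
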